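(* Let $X,Y$ be semi-rectifiable compact plane sets, let $\mathcal{F}$ be an effective collection of paths in $X$, and let $\mathcal{G}$ be an effective collection of paths in $Y$. Let $\varphi\in D_{\mathcal{F}}^{(1)}(X)$ with $\varphi(X)\subseteq Y$. Suppose that $\varphi$ is $\mathcal{F}$-$\mathcal{G}$-compatible. Then, for all $f\in D_{\mathcal{G}}^{(1)}(Y)$, $f\circ\varphi$ is $\mathcal{F}$-differentiable and $(f\circ\varphi)^{[1]}=(f^{[1]}\circ\varphi)\,\varphi^{[1]}$.
   Context: A compact plane set is a non-empty compact subset of $\mathbb{C}$. $C(X)$ is the algebra of continuous complex-valued functions on $X$. Paths: A path is a continuous map $\gamma:[a,b]\to\mathbb{C}$ with $a<b$ real; $\gamma^-=\gamma(a)$, $\gamma^+=\gamma(b)$, and $\gamma^*=\gamma([a,b])$; $\gamma$ is a path in $X$ if $\gamma^*\subseteq X$. A subpath of $\gamma$ is a restriction of $\gamma$ to a non-degenerate closed subinterval of $[a,b]$. $\gamma$ is rectifiable if its total variation is finite, and then its length $\Lambda(\gamma)$ is $V_a^b(\gamma)$, where $V_c^d(\gamma)$ is the total variation of $\gamma$ over $[c,d]$. $\gamma$ is a Jordan path if it is injective. $\gamma$ is admissible if it is rectifiable and has no constant subpaths. For a non-constant rectifiable path $\gamma$, the path length parametrisation $\gamma^{\mathrm{pl}}:[0,\Lambda(\gamma)]\to\mathbb{C}$ is the unique path with $\gamma^{\mathrm{pl}}(V_a^t(\gamma))=\gamma(t)$ for all $t\in[a,b]$. Integrals $\int_\gamma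 f(z)\,dz$ along rectifiable paths are Riemann–Stieltjes integrals. A compact plane set $X$ is semi-rectifiable if the union of the images of all rectifiable Jordan paths in $X$ is dense in $X$. A collection $\mathcal{F}$ of paths in $X$ is effective if $\bigcup_{\gamma\in\mathcal{F}}\gamma^*$ is dense in $X$, each path in $\mathcal{F}$ is admissible, and every subpath of a path in $\mathcal{F}$ belongs to $\mathcal{F}$. $\mathcal{F}$-derivatives: For $f\in C(X)$, a function $g\in C(X)$ is an $\mathcal{F}$-derivative of $f$ if $\int_\gamma g(z)\,dz=f(\gamma^+)-f(\gamma^-)$ for each $\gamma\in\mathcal{F}$; $f$ is $\mathcal{F}$-differentiable if it has an $\mathcal{F}$-derivative. When $X$ is semi-rectifiable and $\mathcal{F}$ is effective, the $\mathcal{F}$-derivative is unique and is denoted $f^{[1]}$; $D_{\mathcal{F}}^{(1)}(X)$ is the set of all $\mathcal{F}$-differentiable functions in $C(X)$. (Similarly for $\mathcal{G}$ and $Y$; $f^{[1]}$ for $f\in D_{\mathcal G}^{(1)}(Y)$ is the $\mathcal{G}$-derivative.) Compatibility: For an admissible path $\gamma$ in $Y$ and $f,g\in C(Y)$, $g$ is the $\gamma$-derivative of $f$ if $\int_\sigma g(z)\,dz=f(\sigma^+)-f(\sigma^-)$ for each subpath $\sigma$ of $\gamma$. $\mathfrak{m}(\mathcal{G})$ is the collection of all admissible paths $\gamma$ in $Y$ such that, for every $f\in D_{\mathcal{G}}^{(1)}(Y)$, $f^{[1]}$ is the $\gamma$-derivative of $f$. A function $\varphi\in D_{\mathcal{F}}^{(1)}(X)$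 with $\varphi(X)\subseteq Y$ is $\mathcal{F}$-$\mathcal{G}$-compatible if, for each $\gamma\in\mathcal{F}$, either $\varphi\circ\gamma$ is constant or $(\varphi\circ\gamma)^{\mathrm{pl}}\in\mathfrak{m}(\mathcal{G})$. *)

theory Defs
  imports "HOL-Analysis.Analysis"
begin

definition compact_plane_set :: "complex set \<Rightarrow> bool" where
  "compact_plane_set X \<longleftrightarrow> compact X \<and> X \<noteq> {}"

text \<open>Members of \<open>C(X)\<close> are extensional, so that equality in \<open>C(X)\<close> is equality
  of functions on \<open>X\<close> and derivatives can be unique as HOL functions.\<close>
definition CX :: "complex set \<Rightarrow> (complex \<Rightarrow> complex) set" where
  "CX X = {f. continuous_on X f \<and> f \<in> extensional X}"


subsection \<open>Paths\<close>

text \<open>The library's paths all live on \<open>[0,1]\<close>; here the parameter interval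
  \<open>[lo \<gamma>, hi \<gamma>]\<close> is part of the path, and the function is extensional on it.\<close>
datatype plane_path = Plane_Path (lo: real) (hi: real) (fn: "real \<Rightarrow> complex")

definition dom_path :: "plane_path \<Rightarrow> real set" where
  "dom_path \<gamma> = {lo \<gamma>..hi \<gamma>}"

definition is_path :: "plane_path \<Rightarrow> bool" where
  "is_path \<gamma> \<longleftrightarrow> lo \<gamma> < hi \<gamma> \<and> continuous_on (dom_path \<gamma>) (fn \<gamma>)
     \<and> fn \<gamma> \<in> extensional (dom_path \<gamma>)"

definition initial_pt :: "plane_path \<Rightarrow> complex" where
  "initial_pt \<gamma> = fn \<gamma> (lo \<gamma>)"

definition final_pt :: "plane_path \<Rightarrow> complex" where
  "final_pt \<gamma> = fn \<gamma> (hi \<gamma>)"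

definition path_trace :: "plane_path \<Rightarrow> complex set" where
  "path_trace \<gamma> = fn \<gamma> ` dom_path \<gamma>"

definition is_path_in :: "plane_path \<Rightarrow> complex set \<Rightarrow> bool" where
  "is_path_in \<gamma> X \<longleftrightarrow> is_path \<gamma> \<and> path_trace \<gamma> \<subseteq> X"

definition constant_path :: "plane_path \<Rightarrow> bool" where
  "constant_path \<gamma> \<longleftrightarrow> fn \<gamma> constant_on dom_path \<gamma>"

definition subpaths :: "plane_path \<Rightarrow> plane_path set" where
  "subpaths \<gamma> = {Plane_Path c d (restrict (fn \<gamma>) {c..d}) | c d.
     lo \<gamma> \<le> c \<and> c < d \<and> d \<le> hi \<gamma>}"

text \<open>For \<open>\<phi>\<close> defined on the trace of \<open>\<gamma>\<close>.\<close>
definition comp_path :: "(complex \<Rightarrow> complex) \<Rightarrow> plane_path \<Rightarrow> plane_path" where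
  "comp_path \<phi> \<gamma> = Plane_Path (lo \<gamma>) (hi \<gamma>) (compose (dom_path \<gamma>) \<phi> (fn \<gamma>))"


subsection \<open>Total variation, rectifiability, path length parametrisation\<close>

text \<open>\<open>c = t 0 \<le> t 1 \<le> \<dots> \<le> t n = d\<close>; only the values \<open>t 0, \<dots>, t n\<close> are relevant.\<close>
definition is_partition :: "real \<Rightarrow> real \<Rightarrow> nat \<Rightarrow> (nat \<Rightarrow> real) \<Rightarrow> bool" where
  "is_partition c d n t \<longleftrightarrow> t 0 = c \<and> t n = d \<and> (\<forall>i<n. t i \<le> t (Suc i))"

definition variation_sums :: "(real \<Rightarrow> complex) \<Rightarrow> real \<Rightarrow> real \<Rightarrow> real set" where
  "variation_sums h c d =
     {\<Sum>i<n. norm (h (t (Suc i)) - h (t i)) | n t. is_partition c d n t}"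

text \<open>Meaningful only if the variation is finite, that is, if \<open>variation_sums h c d\<close>
  is bounded above.\<close>
definition total_variation :: "(real \<Rightarrow> complex) \<Rightarrow> real \<Rightarrow> real \<Rightarrow> real" where
  "total_variation h c d = Sup (variation_sums h c d)"

definition rectifiable :: "plane_path \<Rightarrow> bool" where
  "rectifiable \<gamma> \<longleftrightarrow> is_path \<gamma> \<and> bdd_above (variation_sums (fn \<gamma>) (lo \<gamma>) (hi \<gamma>))"

definition path_len :: "plane_path \<Rightarrow> real" where
  "path_len \<gamma> = total_variation (fn \<gamma>) (lo \<gamma>) (hi \<gamma>)"

definition jordan_path :: "plane_path \<Rightarrow> bool" where
  "jordan_path \<gamma> \<longleftrightarrow> is_path \<gamma> \<and> inj_on (fn \<gamma>) (dom_path \<gamma>)"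

definition admissible :: "plane_path \<Rightarrow> bool" where
  "admissible \<gamma> \<longleftrightarrow> rectifiable \<gamma> \<and> (\<forall>\<sigma>\<in>subpaths \<gamma>. \<not> constant_path \<sigma>)"

text \<open>Exists and is unique when \<open>\<gamma>\<close> is rectifiable and non-constant.\<close>
definition pl_param :: "plane_path \<Rightarrow> plane_path" where
  "pl_param \<gamma> = (THE \<sigma>. is_path \<sigma> \<and> lo \<sigma> = 0 \<and> hi \<sigma> = path_len \<gamma> \<and>
     (\<forall>t\<in>dom_path \<gamma>. fn \<sigma> (total_variation (fn \<gamma>) (lo \<gamma>) t) = fn \<gamma> t))"


subsection \<open>Riemann--Stieltjes integrals along paths\<close>

definition has_RS_integral ::
    "(real \<Rightarrow> complex) \<Rightarrow> (real \<Rightarrow> complex) \<Rightarrow> complex \<Rightarrow> real \<Rightarrow> real \<Rightarrow> bool" where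
  "has_RS_integral u h I a b \<longleftrightarrow>
     (\<forall>\<epsilon>>0. \<exists>\<delta>>0. \<forall>n t s. is_partition a b n t
        \<and> (\<forall>i<n. t (Suc i) - t i < \<delta> \<and> s i \<in> {t i..t (Suc i)})
        \<longrightarrow> norm ((\<Sum>i<n. u (s i) * (h (t (Suc i)) - h (t i))) - I) < \<epsilon>)"

text \<open>\<open>\<integral>\<^sub>\<gamma> g(z) dz\<close> exists and equals \<open>I\<close>.\<close>
definition has_path_integral :: "(complex \<Rightarrow> complex) \<Rightarrow> complex \<Rightarrow> plane_path \<Rightarrow> bool" where
  "has_path_integral g I \<gamma> \<longleftrightarrow>
     has_RS_integral (\<lambda>t. g (fn \<gamma> t)) (fn \<gamma>) I (lo \<gamma>) (hi \<gamma>)"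


subsection \<open>Semi-rectifiable sets, effective collections, derivatives\<close>

definition semi_rectifiable :: "complex set \<Rightarrow> bool" where
  "semi_rectifiable X \<longleftrightarrow> compact_plane_set X \<and>
     X \<subseteq> closure (\<Union>{path_trace \<gamma> | \<gamma>. is_path_in \<gamma> X \<and> rectifiable \<gamma> \<and> jordan_path \<gamma>})"

definition effective :: "complex set \<Rightarrow> plane_path set \<Rightarrow> bool" where
  "effective X F \<longleftrightarrow> (\<forall>\<gamma>\<in>F. is_path_in \<gamma> X) \<and>
     X \<subseteq> closure (\<Union>\<gamma>\<in>F. path_trace \<gamma>) \<and>
     (\<forall>\<gamma>\<in>F. admissible \<gamma>) \<and>
     (\<forall>\<gamma>\<in>F. subpaths \<gamma> \<subseteq> F)"

definition is_F_derivative ::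
    "complex set \<Rightarrow> plane_path set \<Rightarrow> (complex \<Rightarrow> complex) \<Rightarrow> (complex \<Rightarrow> complex) \<Rightarrow> bool" where
  "is_F_derivative X F f g \<longleftrightarrow> f \<in> CX X \<and> g \<in> CX X \<and>
     (\<forall>\<gamma>\<in>F. has_path_integral g (f (final_pt \<gamma>) - f (initial_pt \<gamma>)) \<gamma>)"

definition F_differentiable ::
    "complex set \<Rightarrow> plane_path set \<Rightarrow> (complex \<Rightarrow> complex) \<Rightarrow> bool" where
  "F_differentiable X F f \<longleftrightarrow> (\<exists>g. is_F_derivative X F f g)"

definition D1 :: "complex set \<Rightarrow> plane_path set \<Rightarrow> (complex \<Rightarrow> complex) set" where
  "D1 X F = {f \<in> CX X. F_differentiable X F f}"

text \<open>\<open>f\<^sup>[\<^sup>1\<^sup>]\<close>, which is unique when \<open>F\<close> is effective and \<open>f \<in> D1 X F\<close>.\<close>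
definition F_deriv ::
    "complex set \<Rightarrow> plane_path set \<Rightarrow> (complex \<Rightarrow> complex) \<Rightarrow> complex \<Rightarrow> complex" where
  "F_deriv X F f = (THE g. is_F_derivative X F f g)"


subsection \<open>Compatibility\<close>

definition is_path_derivative ::
    "complex set \<Rightarrow> plane_path \<Rightarrow> (complex \<Rightarrow> complex) \<Rightarrow> (complex \<Rightarrow> complex) \<Rightarrow> bool" where
  "is_path_derivative Y \<gamma> f g \<longleftrightarrow> f \<in> CX Y \<and> g \<in> CX Y \<and>
     (\<forall>\<sigma>\<in>subpaths \<gamma>. has_path_integral g (f (final_pt \<sigma>) - f (initial_pt \<sigma>)) \<sigma>)"

definition m_paths :: "complex set \<Rightarrow> plane_path set \<Rightarrow> plane_path set" where
  "m_paths Y G = {\<gamma>. is_path_in \<gamma> Y \<and> admissible \<gamma> \<and>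
     (\<forall>f\<in>D1 Y G. is_path_derivative Y \<gamma> f (F_deriv Y G f))}"

definition compatible ::
    "complex set \<Rightarrow> plane_path set \<Rightarrow> complex set \<Rightarrow> plane_path set \<Rightarrow> (complex \<Rightarrow> complex) \<Rightarrow> bool" where
  "compatible X F Y G \<phi> \<longleftrightarrow> \<phi> \<in> D1 X F \<and> \<phi> ` X \<subseteq> Y \<and>
     (\<forall>\<gamma>\<in>F. constant_path (comp_path \<phi> \<gamma>) \<or> pl_param (comp_path \<phi> \<gamma>) \<in> m_paths Y G)"

end

theory Submission
  imports Defs
begin

text \<open>Fix a path \<open>\<gamma>\<close> of \<open>F\<close>, write \<open>h = \<phi> \<circ> \<gamma>\<close>, \<open>p\<close> for the derivative of \<open>\<phi>\<close> and \<open>g\<close>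
  for the derivative of \<open>f\<close>. The theorem holds because of two transformations
  of Riemann--Stieltjes integrals:
  the integral of \<open>(g \<circ> \<phi>) p\<close> along \<open>\<gamma>\<close> equals \<open>\<integral> (g \<circ> h) dh\<close>, which equals the integral of \<open>g\<close>
  along the path length parametrisation \<open>h\<^sup>p\<^sup>l\<close>, and this is the difference of the values
  of \<open>f \<circ> \<phi>\<close> at the ends of \<open>\<gamma>\<close>.

  The first equality (\<open>has_RS_integral_mult_density\<close>) expresses that \<open>dh = p d\<gamma>\<close>. Since
  \<open>F\<close> is closed under subpaths, every increment of \<open>h\<close> is the integral of
  \<open>p \<circ> \<gamma>\<close> along the corresponding piece of \<open>\<gamma>\<close>; on a short piece this integral differs from
  the single term \<open>p (\<gamma> s) (\<gamma> d - \<gamma> c)\<close> by at most the oscillation of \<open>p \<circ> \<gamma>\<close> times the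
  variation of \<open>\<gamma>\<close> (\<open>RS_integral_minus_const_bound\<close>). The errors add up to a small
  multiple of the length of \<open>\<gamma>\<close>. The same bound shows that \<open>h\<close> is rectifiable.

  The second equality (\<open>path_integral_from_pl_param\<close>) is a change of parameter by the
  variation function \<open>V\<close> of \<open>h\<close>: a Riemann sum of the one integral is a
  Riemann sum of the other. It requires that \<open>V\<close> is continuous
  (\<open>continuous_on_total_variation\<close>), which also yields the existence of
  \<open>h\<^sup>p\<^sup>l\<close>. The last equality is compatibility, applied to \<open>h\<^sup>p\<^sup>l\<close> as a
  subpath of itself. If \<open>h\<close> is constant, both ends of the chain vanish.

  Hence the function in the theorem is an \<open>F\<close>-derivative of \<open>f \<circ> \<phi>\<close>. It is the only one:
  if two derivatives of one function differed at a point of a path in \<open>F\<close>, then near that point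
  every increment of the path would be at most half of its variation, so the variation would
  vanish there and the path would contain a constant subpath.\<close>

section \<open>Partitions and total variation\<close>

lemma partition_mono:
  assumes "is_partition a b n t" "i \<le> j" "j \<le> n"
  shows "t i \<le> t j"
  using assms(2,3)
proof (induction j rule: dec_induct)
  case (step m)
  then have "t m \<le> t (Suc m)"
    using assms(1) by (auto simp: is_partition_def)
  with step show ?case by simp
qed simp

lemma partition_in_interval:
  assumes "is_partition a b n t" "i \<le> n"
  shows "t i \<in> {a..b}"
  using partition_mono[OF assms(1), of 0 i] partition_mono[OF assms(1), of i n] assms
  by (auto simp: is_partition_def)

lemma partition_tag_in_interval:
  assumes "is_partition a b n t" "i < n" "s \<in> {t i..t (Suc i)}"
  shows "s \<in> {a..b}"
  using partition_in_interval[OF assms(1), of i] partition_in_interval[OF assms(1), of "Suc i"] assms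
  by auto

lemma fine_partition_exists:
  assumes "a \<le> b" "0 < \<delta>"
  obtains n t where "is_partition a b n t" "\<And>i. i < n \<Longrightarrow> t (Suc i) - t i < \<delta>"
proof -
  obtain n where n: "(b - a) / \<delta> < real n" "n > 0"
    by (metis assms divide_nonneg_pos diff_ge_0_iff_ge le_less_trans of_nat_0_less_iff reals_Archimedean2)
  define t where "t i = a + real i * ((b - a) / real n)" for i
  have step: "t (Suc i) - t i = (b - a) / real n" for i
    by (simp add: t_def algebra_simps add_divide_distrib diff_divide_distrib)
  have small: "(b - a) / real n < \<delta>"
    using n assms by (simp add: field_simps)
  have "0 \<le> (b - a) / real n"
    using assms by simp
  then have "t i \<le> t (Suc i)" for i
    using step[of i] by linarith
  then have "is_partition a b n t"
    using n by (simp add: is_partition_def) (simp add: t_def)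
  then show thesis
    using that small step by simp
qed

lemma sum_lessThan_add:
  fixes f :: "nat \<Rightarrow> 'a::comm_monoid_add"
  shows "sum f {..<n + m} = sum f {..<n} + (\<Sum>i<m. f (n + i))"
  by (induction m) (simp_all add: add.assoc)

lemma partition_join:
  assumes t: "is_partition a b n t" and u: "is_partition b c m u"
  obtains w where "is_partition a c (n + m) w"
    "\<And>i. i \<le> n \<Longrightarrow> w i = t i" "\<And>i. i \<le> m \<Longrightarrow> w (n + i) = u i"
proof -
  define w where "w i = (if i \<le> n then t i else u (i - n))" for i
  have 1: "w i = t i" if "i \<le> n" for i
    using that by (simp add: w_def)
  have 2: "w (n + i) = u i" if "i \<le> m" for i
    using t u by (auto simp: w_def is_partition_def)
  have "w i \<le> w (Suc i)" if "i < n + m" for i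
  proof (cases "i < n")
    case True
    then show ?thesis using t by (simp add: w_def is_partition_def)
  next
    case False
    define j where "j = i - n"
    then have j: "i = n + j" "j < m"
      using that False by auto
    then show ?thesis
      using 2[of j] 2[of "Suc j"] u by (simp add: is_partition_def)
  qed
  moreover have "w 0 = a" "w (n + m) = c"
    using 1[of 0] 2[of m] t u by (simp_all add: is_partition_def)
  ultimately have "is_partition a c (n + m) w"
    by (simp add: is_partition_def)
  then show thesis using that 1 2 by blast
qed

lemma variation_sums_join:
  assumes "x \<in> variation_sums h a b" "y \<in> variation_sums h b c"
  shows "x + y \<in> variation_sums h a c"
proof -
  obtain n t where t: "is_partition a b n t" "x = (\<Sum>i<n. norm (h (t (Suc i)) - h (t i)))"
    using assms(1) by (auto simp: variation_sums_def)
  obtain m u where u: "is_partition b c m u" "y = (\<Sum>i<m. norm (h (u (Suc i)) - h (u i)))"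
    using assms(2) by (auto simp: variation_sums_def)
  obtain w where w: "is_partition a c (n + m) w"
    "\<And>i. i \<le> n \<Longrightarrow> w i = t i" "\<And>i. i \<le> m \<Longrightarrow> w (n + i) = u i"
    using partition_join[OF t(1) u(1)] by blast
  have "(\<Sum>i<n + m. norm (h (w (Suc i)) - h (w i))) = x + y"
    unfolding sum_lessThan_add t(2) u(2)
    using w(2) w(3) w(3)[of "Suc _"] by (intro arg_cong2[of _ _ _ _ "(+)"] sum.cong) auto
  then show ?thesis
    using w(1) unfolding variation_sums_def by force
qed

lemma norm_diff_in_variation_sums:
  assumes "a \<le> b"
  shows "norm (h b - h a) \<in> variation_sums h a b"
  unfolding variation_sums_def mem_Collect_eq
  by (rule exI[of _ "Suc 0"], rule exI[of _ "\<lambda>i. if i = 0 then a else b"])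
     (use assms in \<open>auto simp: is_partition_def\<close>)

lemma variation_sums_nonempty: "a \<le> b \<Longrightarrow> variation_sums h a b \<noteq> {}"
  using norm_diff_in_variation_sums by blast

lemma bdd_above_variation_sums_subinterval:
  assumes "bdd_above (variation_sums h a b)" "a \<le> c" "c \<le> d" "d \<le> b"
  shows "bdd_above (variation_sums h c d)"
proof -
  obtain M where M: "\<And>x. x \<in> variation_sums h a b \<Longrightarrow> x \<le> M"
    using assms(1) by (auto simp: bdd_above_def)
  have "x \<le> M" if "x \<in> variation_sums h c d" for x
  proof -
    have "norm (h c - h a) + x + norm (h b - h d) \<in> variation_sums h a b"
      using that assms by (blast intro: variation_sums_join norm_diff_in_variation_sums)
    from M[OF this] show ?thesis
      using norm_ge_zero[of "h c - h a"] norm_ge_zero[of "h b - h d"] by linarith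
  qed
  then show ?thesis by (rule bdd_aboveI)
qed

lemma variation_sum_le_total_variation:
  assumes "bdd_above (variation_sums h a b)" "is_partition a b n t"
  shows "(\<Sum>i<n. norm (h (t (Suc i)) - h (t i))) \<le> total_variation h a b"
  unfolding total_variation_def
  by (rule cSup_upper[OF _ assms(1)]) (use assms(2) in \<open>auto simp: variation_sums_def\<close>)

lemma norm_diff_le_total_variation:
  assumes "bdd_above (variation_sums h a b)" "a \<le> b"
  shows "norm (h b - h a) \<le> total_variation h a b"
  unfolding total_variation_def
  by (rule cSup_upper[OF norm_diff_in_variation_sums assms(1)]) fact

lemma total_variation_nonneg:
  assumes "bdd_above (variation_sums h a b)" "a \<le> b"
  shows "0 \<le> total_variation h a b"
  using norm_diff_le_total_variation[OF assms] norm_ge_zero order_trans by blast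

lemma total_variation_least:
  assumes "a \<le> b"
    and "\<And>n t. is_partition a b n t \<Longrightarrow> (\<Sum>i<n. norm (h (t (Suc i)) - h (t i))) \<le> M"
  shows "total_variation h a b \<le> M"
  unfolding total_variation_def
  by (rule cSup_least[OF variation_sums_nonempty[OF assms(1)]])
     (use assms(2) in \<open>auto simp: variation_sums_def\<close>)

text \<open>A partition of \<open>[a, b]\<close> followed by one of \<open>[b, c]\<close> is a partition of \<open>[a, c]\<close>.\<close>
lemma total_variation_superadditive:
  assumes bdd: "bdd_above (variation_sums h a c)" and "a \<le> b" "b \<le> c"
  shows "total_variation h a b + total_variation h b c \<le> total_variation h a c"
proof -
  have "x + y \<le> total_variation h a c"
    if "x \<in> variation_sums h a b" "y \<in> variation_sums h b c" for x y
    unfolding total_variation_def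
    using variation_sums_join[OF that] bdd by (rule cSup_upper)
  then have "y \<le> total_variation h a c - x"
    if "x \<in> variation_sums h a b" "y \<in> variation_sums h b c" for x y
    using that by (simp add: algebra_simps)
  then have "total_variation h b c \<le> total_variation h a c - x"
    if "x \<in> variation_sums h a b" for x
    unfolding total_variation_def[of h b c]
    using that assms by (intro cSup_least variation_sums_nonempty) auto
  then have "x \<le> total_variation h a c - total_variation h b c"
    if "x \<in> variation_sums h a b" for x
    using that by (simp add: algebra_simps)
  then have "total_variation h a b \<le> total_variation h a c - total_variation h b c"
    unfolding total_variation_def[of h a b]
    using assms by (intro cSup_least variation_sums_nonempty) auto
  then show ?thesis by simp
qed

lemma sum_total_variation_le:
  assumes "bdd_above (variation_sums h a b)" "is_partition a b n t"
  shows "(\<Sum>i<n. total_variation h (t i) (t (Suc i))) \<le> total_variation h a b"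
proof -
  have "(\<Sum>i<m. total_variation h (t i) (t (Suc i))) \<le> total_variation h a (t m)" if "m \<le> n" for m
    using that
  proof (induction m)
    case 0
    then show ?case
      using assms partition_in_interval[OF assms(2), of 0]
      by (auto intro!: total_variation_nonneg bdd_above_variation_sums_subinterval[OF assms(1)])
  next
    case (Suc m)
    have mem: "t m \<in> {a..b}" "t (Suc m) \<in> {a..b}" "t m \<le> t (Suc m)"
      using Suc.prems partition_in_interval[OF assms(2)] assms(2) by (auto simp: is_partition_def)
    have "total_variation h a (t m) + total_variation h (t m) (t (Suc m))
        \<le> total_variation h a (t (Suc m))"
      using mem by (intro total_variation_superadditive
          bdd_above_variation_sums_subinterval[OF assms(1)]) auto
    with Suc show ?case by simp
  qed
  from this[of n] show ?thesis using assms(2) by (simp add: is_partition_def)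
qed

lemma norm_diff_le_variation_diff:
  assumes bdd: "bdd_above (variation_sums h a b)" and "a \<le> s" "s \<le> t" "t \<le> b"
  shows "norm (h t - h s) \<le> total_variation h a t - total_variation h a s"
proof -
  have "norm (h t - h s) \<le> total_variation h s t"
    using assms by (intro norm_diff_le_total_variation bdd_above_variation_sums_subinterval[OF bdd])
  moreover have "total_variation h a s + total_variation h s t \<le> total_variation h a t"
    using assms
    by (intro total_variation_superadditive bdd_above_variation_sums_subinterval[OF bdd]) auto
  ultimately show ?thesis by linarith
qed

lemma mono_on_total_variation:
  assumes "bdd_above (variation_sums h a b)"
  shows "mono_on {a..b} (total_variation h a)"
proof (rule mono_onI)
  fix s t assume "s \<in> {a..b}" "t \<in> {a..b}" "s \<le> t"
  then have "norm (h t - h s) \<le> total_variation h a t - total_variation h a s"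
    using norm_diff_le_variation_diff[OF assms, of s t] by simp
  then show "total_variation h a s \<le> total_variation h a t"
    using norm_ge_zero[of "h t - h s"] by linarith
qed

lemma total_variation_point: "total_variation h a a = 0"
proof -
  have "(\<Sum>i<n. norm (h (t (Suc i)) - h (t i))) = 0" if "is_partition a a n t" for n t
    using partition_in_interval[OF that] by (intro sum.neutral) auto
  then have "variation_sums h a a \<subseteq> {0}"
    by (auto simp: variation_sums_def)
  then have "variation_sums h a a = {0}"
    using variation_sums_nonempty[of a a h] by auto
  then show ?thesis by (simp add: total_variation_def)
qed

text \<open>A partition of \<open>[a, b]\<close> whose sum is within \<open>\<epsilon>\<close> of the supremum is cut at each \<open>x\<close>.
  Its part \<open>S x\<close> to the left of \<open>x\<close> bounds \<open>V(a, x)\<close> from below and its part \<open>T x\<close> to the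
  right bounds \<open>V(x, b)\<close> from below. The two parts sum to more than \<open>V(a, b) - \<epsilon>\<close>, hence
  \<open>S x\<close> is within \<open>\<epsilon>\<close> of \<open>V(a, x)\<close>, for all \<open>x\<close> at once. As the cut varies continuously, so does
  \<open>S\<close>, and the variation function is a uniform limit of continuous functions.\<close>
lemma continuous_on_total_variation:
  assumes bdd: "bdd_above (variation_sums h a b)" and "a \<le> b" and cont: "continuous_on {a..b} h"
  shows "continuous_on {a..b} (total_variation h a)"
proof -
  define good where "good \<epsilon> S \<longleftrightarrow> continuous_on {a..b} S \<and>
      (\<forall>x\<in>{a..b}. dist (S x) (total_variation h a x) < \<epsilon>)" for \<epsilon> :: real and S :: "real \<Rightarrow> real"
  have approx: "\<exists>S. good \<epsilon> S" if "\<epsilon> > 0" for \<epsilon>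
  proof -
    have "total_variation h a b - \<epsilon> < Sup (variation_sums h a b)"
      using that by (simp add: total_variation_def)
    then obtain n t where t: "is_partition a b n t"
      and close: "total_variation h a b - \<epsilon> < (\<Sum>i<n. norm (h (t (Suc i)) - h (t i)))"
      using less_cSupE[OF _ variation_sums_nonempty[OF \<open>a \<le> b\<close>, of h]]
      unfolding variation_sums_def by blast
    define S where "S x = (\<Sum>i<n. norm (h (min (t (Suc i)) x) - h (min (t i) x)))" for x
    define T where "T x = (\<Sum>i<n. norm (h (max (t (Suc i)) x) - h (max (t i) x)))" for x
    have mem: "t i \<in> {a..b}" if "i \<le> n" for i
      using partition_in_interval[OF t that] .
    have "continuous_on {a..b} (\<lambda>x. h (min (t i) x))" if "i \<le> n" for i
      by (rule continuous_on_compose2[OF cont]) (use mem[OF that] in \<open>auto intro!: continuous_intros\<close>)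
    then have "continuous_on {a..b} S"
      unfolding S_def by (intro continuous_intros) auto
    moreover have "dist (S x) (total_variation h a x) < \<epsilon>" if x: "x \<in> {a..b}" for x
    proof -
      have "is_partition a x n (\<lambda>i. min (t i) x)" "is_partition x b n (\<lambda>i. max (t i) x)"
        using t x by (auto simp: is_partition_def min_def max_def intro: order_trans)
      then have S: "S x \<le> total_variation h a x" and T: "T x \<le> total_variation h x b"
        unfolding S_def T_def using x
        by (auto intro!: variation_sum_le_total_variation bdd_above_variation_sums_subinterval[OF bdd])
      \<comment> \<open>Cutting at \<open>x\<close> inserts one point in a single interval, so the sum cannot decrease.\<close>
      have "norm (h (t (Suc i)) - h (t i)) \<le> norm (h (min (t (Suc i)) x) - h (min (t i) x))
          + norm (h (max (t (Suc i)) x) - h (max (t i) x))" if "i < n" for i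
      proof -
        have "t i \<le> t (Suc i)"
          using t that by (simp add: is_partition_def)
        then show ?thesis
          using norm_triangle_ineq[of "h x - h (t i)" "h (t (Suc i)) - h x"]
          by (auto simp: min_def max_def)
      qed
      then have "(\<Sum>i<n. norm (h (t (Suc i)) - h (t i))) \<le> S x + T x"
        unfolding S_def T_def sum.distrib[symmetric] by (intro sum_mono) auto
      moreover have "total_variation h a x + total_variation h x b \<le> total_variation h a b"
        using x by (intro total_variation_superadditive[OF bdd]) auto
      ultimately show ?thesis
        using close S T by (simp add: dist_real_def)
    qed
    ultimately show ?thesis by (auto simp: good_def)
  qed
  define S where "S k = (SOME S. good (1 / real (Suc k)) S)" for k
  have S: "good (1 / real (Suc k)) (S k)" for k
    unfolding S_def by (rule someI_ex[OF approx]) simp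
  have "uniform_limit {a..b} S (total_variation h a) sequentially"
  proof (rule uniform_limitI)
    fix e :: real assume "e > 0"
    then have "\<forall>\<^sub>F k in sequentially. 1 / real (Suc k) < e"
      using LIMSEQ_inverse_real_of_nat by (auto simp: order_tendsto_iff inverse_eq_divide)
    then show "\<forall>\<^sub>F k in sequentially. \<forall>x\<in>{a..b}. dist (S k x) (total_variation h a x) < e"
      by eventually_elim (use S in \<open>auto simp: good_def intro: less_trans\<close>)
  qed
  then show ?thesis
    using S by (intro uniform_limit_theorem[of _ S sequentially]) (auto simp: good_def)
qed

section \<open>Riemann--Stieltjes integrals\<close>

lemma has_RS_integral_cong:
  assumes "has_RS_integral u h I a b"
    and eq: "\<And>x. x \<in> {a..b} \<Longrightarrow> u' x = u x" "\<And>x. x \<in> {a..b} \<Longrightarrow> h' x = h x"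
  shows "has_RS_integral u' h' I a b"
  unfolding has_RS_integral_def
proof (intro allI impI)
  fix \<epsilon> :: real assume "\<epsilon> > 0"
  then obtain \<delta> where \<delta>: "\<delta> > 0"
    "\<And>n t s. is_partition a b n t \<and> (\<forall>i<n. t (Suc i) - t i < \<delta> \<and> s i \<in> {t i..t (Suc i)})
        \<Longrightarrow> norm ((\<Sum>i<n. u (s i) * (h (t (Suc i)) - h (t i))) - I) < \<epsilon>"
    using assms(1) unfolding has_RS_integral_def by meson
  have "norm ((\<Sum>i<n. u' (s i) * (h' (t (Suc i)) - h' (t i))) - I) < \<epsilon>"
    if t: "is_partition a b n t" and s: "\<forall>i<n. t (Suc i) - t i < \<delta> \<and> s i \<in> {t i..t (Suc i)}" for n t s
  proof -
    have "u' (s i) * (h' (t (Suc i)) - h' (t i)) = u (s i) * (h (t (Suc i)) - h (t i))" if "i < n" for i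
      using partition_tag_in_interval[OF t that, of "s i"] partition_in_interval[OF t, of i]
        partition_in_interval[OF t, of "Suc i"] that s by (simp add: eq)
    then show ?thesis using \<delta>(2)[of n t s] t s by simp
  qed
  then show "\<exists>\<delta>>0. \<forall>n t s. is_partition a b n t \<and> (\<forall>i<n. t (Suc i) - t i < \<delta> \<and> s i \<in> {t i..t (Suc i)})
      \<longrightarrow> norm ((\<Sum>i<n. u' (s i) * (h' (t (Suc i)) - h' (t i))) - I) < \<epsilon>"
    using \<delta>(1) by blast
qed

lemma has_RS_integral_constant_integrator:
  assumes "\<And>x. x \<in> {a..b} \<Longrightarrow> h x = c"
  shows "has_RS_integral u h 0 a b"
proof -
  have "has_RS_integral u (\<lambda>_. c) 0 a b"
    unfolding has_RS_integral_def by (auto intro: exI[of _ 1])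
  then show ?thesis
    by (rule has_RS_integral_cong) (use assms in auto)
qed

text \<open>A constant integrand \<open>w\<close> has telescoping sums, so only the deviation of \<open>u\<close> from \<open>w\<close>
  contributes. With \<open>w = 0\<close> this bounds the increments of an indefinite integral; with \<open>w\<close> a
  value of \<open>u\<close> it replaces an integral over a short interval by a single term.\<close>
lemma RS_integral_minus_const_bound:
  assumes int: "has_RS_integral u h I a b" and "a \<le> b"
    and bdd: "bdd_above (variation_sums h a b)"
    and close: "\<And>x. x \<in> {a..b} \<Longrightarrow> norm (u x - w) \<le> e"
  shows "norm (I - w * (h b - h a)) \<le> e * total_variation h a b"
proof (rule field_le_epsilon)
  fix \<epsilon> :: real assume "\<epsilon> > 0"
  then obtain \<delta> where \<delta>: "\<delta> > 0"
    "\<And>n t s. is_partition a b n t \<and> (\<forall>i<n. t (Suc i) - t i < \<delta> \<and> s i \<in> {t i..t (Suc i)})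
        \<Longrightarrow> norm ((\<Sum>i<n. u (s i) * (h (t (Suc i)) - h (t i))) - I) < \<epsilon>"
    using int unfolding has_RS_integral_def by meson
  obtain n t where t: "is_partition a b n t" "\<And>i. i < n \<Longrightarrow> t (Suc i) - t i < \<delta>"
    using fine_partition_exists[OF \<open>a \<le> b\<close> \<delta>(1)] by blast
  define S where "S = (\<Sum>i<n. u (t i) * (h (t (Suc i)) - h (t i)))"
  have SI: "norm (S - I) < \<epsilon>"
    unfolding S_def using \<delta>(2)[of n t t] t by (auto simp: is_partition_def)
  have e: "0 \<le> e"
    using close[of a] \<open>a \<le> b\<close> norm_ge_zero[of "u a - w"] by (simp, linarith)
  have telescope: "h b - h a = (\<Sum>i<n. h (t (Suc i)) - h (t i))"
    using t(1) sum_lessThan_telescope[of "\<lambda>i. h (t i)" n] by (simp add: is_partition_def)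
  have "S - w * (h b - h a) = (\<Sum>i<n. (u (t i) - w) * (h (t (Suc i)) - h (t i)))"
    by (simp only: telescope S_def sum_distrib_left sum_subtractf[symmetric] left_diff_distrib)
  also have "norm \<dots> \<le> (\<Sum>i<n. e * norm (h (t (Suc i)) - h (t i)))"
    using partition_in_interval[OF t(1)] close
    by (intro sum_norm_le) (simp add: norm_mult mult_right_mono)
  also have "\<dots> \<le> e * total_variation h a b"
    unfolding sum_distrib_left[symmetric]
    by (intro mult_left_mono variation_sum_le_total_variation bdd t(1) e)
  finally have "norm (S - w * (h b - h a)) \<le> e * total_variation h a b" .
  moreover have "norm (I - w * (h b - h a)) \<le> norm (S - w * (h b - h a)) + norm (S - I)"
    using norm_triangle_ineq4[of "S - w * (h b - h a)" "S - I"] by simp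
  ultimately show "norm (I - w * (h b - h a)) \<le> e * total_variation h a b + \<epsilon>"
    using SI by linarith
qed

text \<open>\<open>V\<close> maps tagged partitions of \<open>[a, b]\<close> to tagged partitions of \<open>[V a, V b]\<close> with the same
  Riemann sums, and by uniform continuity fine ones to fine ones. \<open>V\<close> may
  be constant on intervals: partitions may repeat points.\<close>
lemma has_RS_integral_reparametrize:
  assumes int: "has_RS_integral u k I (V a) (V b)"
    and cont: "continuous_on {a..b} V" and mono: "mono_on {a..b} V"
  shows "has_RS_integral (\<lambda>x. u (V x)) (\<lambda>x. k (V x)) I a b"
  unfolding has_RS_integral_def
proof (intro allI impI)
  fix \<epsilon> :: real assume "\<epsilon> > 0"
  then obtain \<eta> where \<eta>: "\<eta> > 0"
    "\<And>n t s. is_partition (V a) (V b) n t \<and> (\<forall>i<n. t (Suc i) - t i < \<eta> \<and> s i \<in> {t i..t (Suc i)})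
        \<Longrightarrow> norm ((\<Sum>i<n. u (s i) * (k (t (Suc i)) - k (t i))) - I) < \<epsilon>"
    using int unfolding has_RS_integral_def by meson
  have "uniformly_continuous_on {a..b} V"
    using cont by (intro compact_uniformly_continuous) auto
  then obtain \<delta> where \<delta>: "\<delta> > 0"
    "\<And>x y. x \<in> {a..b} \<Longrightarrow> y \<in> {a..b} \<Longrightarrow> dist y x < \<delta> \<Longrightarrow> dist (V y) (V x) < \<eta>"
    using \<eta>(1) unfolding uniformly_continuous_on_def by meson
  have "norm ((\<Sum>i<n. u (V (s i)) * (k (V (t (Suc i))) - k (V (t i)))) - I) < \<epsilon>"
    if t: "is_partition a b n t" and s: "\<forall>i<n. t (Suc i) - t i < \<delta> \<and> s i \<in> {t i..t (Suc i)}" for n t s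
  proof (rule \<eta>(2), intro conjI allI impI)
    show "is_partition (V a) (V b) n (\<lambda>i. V (t i))"
      using t partition_in_interval[OF t] mono_onD[OF mono] by (simp add: is_partition_def)
  next
    fix i assume i: "i < n"
    have mem: "t i \<in> {a..b}" "t (Suc i) \<in> {a..b}" "s i \<in> {a..b}" "t i \<le> t (Suc i)"
      "t i \<le> s i" "s i \<le> t (Suc i)"
      using i partition_in_interval[OF t] partition_tag_in_interval[OF t i] s t
      by (auto simp: is_partition_def)
    have "dist (V (t (Suc i))) (V (t i)) < \<eta>"
      using mem i s by (intro \<delta>(2)) (auto simp: dist_real_def)
    then show "V (t (Suc i)) - V (t i) < \<eta>"
      by (simp add: dist_real_def)
    show "V (s i) \<in> {V (t i)..V (t (Suc i))}"
      using mem mono_onD[OF mono] by simp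
  qed
  then show "\<exists>\<delta>>0. \<forall>n t s. is_partition a b n t \<and> (\<forall>i<n. t (Suc i) - t i < \<delta> \<and> s i \<in> {t i..t (Suc i)})
      \<longrightarrow> norm ((\<Sum>i<n. u (V (s i)) * (k (V (t (Suc i))) - k (V (t i)))) - I) < \<epsilon>"
    using \<delta>(1) by blast
qed

lemma bdd_above_variation_sums_indefinite_integral:
  assumes "a \<le> b" and bdd: "bdd_above (variation_sums z a b)"
    and M: "\<And>x. x \<in> {a..b} \<Longrightarrow> norm (p x) \<le> M"
    and int: "\<And>c d. a \<le> c \<Longrightarrow> c < d \<Longrightarrow> d \<le> b \<Longrightarrow> has_RS_integral p z (h d - h c) c d"
  shows "bdd_above (variation_sums h a b)"
proof -
  have M0: "0 \<le> M"
    using M[of a] \<open>a \<le> b\<close> norm_ge_zero[of "p a"] by (simp, linarith)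
  have "(\<Sum>i<n. norm (h (t (Suc i)) - h (t i))) \<le> M * total_variation z a b"
    if t: "is_partition a b n t" for n t
  proof -
    have "norm (h (t (Suc i)) - h (t i)) \<le> M * total_variation z (t i) (t (Suc i))" if i: "i < n" for i
    proof (cases "t i < t (Suc i)")
      case True
      have mem: "t i \<in> {a..b}" "t (Suc i) \<in> {a..b}"
        using i partition_in_interval[OF t] by auto
      have "norm (h (t (Suc i)) - h (t i) - 0 * (z (t (Suc i)) - z (t i)))
          \<le> M * total_variation z (t i) (t (Suc i))"
        using mem True M
        by (intro RS_integral_minus_const_bound[of p] int bdd_above_variation_sums_subinterval[OF bdd]) auto
      then show ?thesis by simp
    next
      case False
      then have "t (Suc i) = t i"
        using t i by (force simp: is_partition_def)
      then show ?thesis by (simp add: total_variation_point)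
    qed
    then have "(\<Sum>i<n. norm (h (t (Suc i)) - h (t i)))
        \<le> M * (\<Sum>i<n. total_variation z (t i) (t (Suc i)))"
      unfolding sum_distrib_left by (intro sum_mono) auto
    also have "\<dots> \<le> M * total_variation z a b"
      by (intro mult_left_mono sum_total_variation_le bdd t M0)
    finally show ?thesis .
  qed
  then show ?thesis
    by (intro bdd_aboveI[of _ "M * total_variation z a b"]) (auto simp: variation_sums_def)
qed

text \<open>If \<open>dh = p dz\<close>, then \<open>\<integral> q dh = \<integral> q p dz\<close>. The integral on the right exists because its
  Riemann sums are compared with those of the left one, whose convergence is assumed.\<close>
lemma has_RS_integral_mult_density:
  assumes "a \<le> b" and bdd: "bdd_above (variation_sums z a b)"
    and p: "continuous_on {a..b} p"
    and B: "\<And>x. x \<in> {a..b} \<Longrightarrow> norm (q x) \<le> B"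
    and int: "\<And>c d. a \<le> c \<Longrightarrow> c < d \<Longrightarrow> d \<le> b \<Longrightarrow> has_RS_integral p z (h d - h c) c d"
    and qh: "has_RS_integral q h I a b"
  shows "has_RS_integral (\<lambda>x. q x * p x) z I a b"
  unfolding has_RS_integral_def
proof (intro allI impI)
  fix \<epsilon> :: real assume "\<epsilon> > 0"
  define L where "L = total_variation z a b"
  have L: "0 \<le> L"
    unfolding L_def using total_variation_nonneg bdd \<open>a \<le> b\<close> by blast
  have B0: "0 \<le> B"
    using B[of a] \<open>a \<le> b\<close> norm_ge_zero[of "q a"] by (simp, linarith)
  \<comment> \<open>The Riemann sums will differ by at most \<open>B \<eta> L\<close>; the summand 1 covers \<open>B L = 0\<close>.\<close>
  define \<eta> where "\<eta> = \<epsilon> / (2 * (B * L + 1))"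
  have BL: "0 < B * L + 1"
    using B0 L by (simp add: add_nonneg_pos)
  have \<eta>: "0 < \<eta>"
    unfolding \<eta>_def using \<open>\<epsilon> > 0\<close> BL by simp
  have "\<eta> * (B * L) \<le> \<eta> * (B * L + 1)"
    using \<eta> by (intro mult_left_mono) auto
  also have "\<dots> = \<epsilon> / 2"
    unfolding \<eta>_def using BL by (simp add: field_simps)
  finally have small: "B * (\<eta> * L) \<le> \<epsilon> / 2" by (simp add: mult_ac)
  obtain \<delta>1 where \<delta>1: "\<delta>1 > 0"
    "\<And>n t s. is_partition a b n t \<and> (\<forall>i<n. t (Suc i) - t i < \<delta>1 \<and> s i \<in> {t i..t (Suc i)})
        \<Longrightarrow> norm ((\<Sum>i<n. q (s i) * (h (t (Suc i)) - h (t i))) - I) < \<epsilon> / 2"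
    using qh half_gt_zero[OF \<open>\<epsilon> > 0\<close>] unfolding has_RS_integral_def by meson
  have "uniformly_continuous_on {a..b} p"
    using p by (intro compact_uniformly_continuous) auto
  then obtain \<delta>2 where \<delta>2: "\<delta>2 > 0"
    "\<And>x y. x \<in> {a..b} \<Longrightarrow> y \<in> {a..b} \<Longrightarrow> dist y x < \<delta>2 \<Longrightarrow> dist (p y) (p x) < \<eta>"
    using \<eta> unfolding uniformly_continuous_on_def by meson
  have "norm ((\<Sum>i<n. q (s i) * p (s i) * (z (t (Suc i)) - z (t i))) - I) < \<epsilon>"
    if t: "is_partition a b n t"
      and s: "\<forall>i<n. t (Suc i) - t i < min \<delta>1 \<delta>2 \<and> s i \<in> {t i..t (Suc i)}" for n t s
  proof -
    define A where "A = (\<Sum>i<n. q (s i) * p (s i) * (z (t (Suc i)) - z (t i)))"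
    define D where "D = (\<Sum>i<n. q (s i) * (h (t (Suc i)) - h (t i)))"
    have DI: "norm (D - I) < \<epsilon> / 2"
      unfolding D_def using t s by (intro \<delta>1(2)) auto
    have loc: "norm (h (t (Suc i)) - h (t i) - p (s i) * (z (t (Suc i)) - z (t i)))
        \<le> \<eta> * total_variation z (t i) (t (Suc i))" if i: "i < n" for i
    proof (cases "t i < t (Suc i)")
      case True
      have mem: "t i \<in> {a..b}" "t (Suc i) \<in> {a..b}" "s i \<in> {a..b}" "t i \<le> s i" "s i \<le> t (Suc i)"
        "t (Suc i) - t i < \<delta>2"
        using i partition_in_interval[OF t] partition_tag_in_interval[OF t i] s by auto
      have "norm (p x - p (s i)) \<le> \<eta>" if "x \<in> {t i..t (Suc i)}" for x
      proof -
        have "dist x (s i) < \<delta>2" "x \<in> {a..b}"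
          using mem that unfolding dist_real_def by auto
        then show ?thesis
          using \<delta>2(2)[of "s i" x] mem(3) by (simp add: dist_norm)
      qed
      then show ?thesis
        using mem True
        by (intro RS_integral_minus_const_bound[of p] int bdd_above_variation_sums_subinterval[OF bdd]) auto
    next
      case False
      then have "t (Suc i) = t i"
        using t i by (force simp: is_partition_def)
      then show ?thesis by (simp add: total_variation_point)
    qed
    have "D - A = (\<Sum>i<n. q (s i) * (h (t (Suc i)) - h (t i) - p (s i) * (z (t (Suc i)) - z (t i))))"
      by (simp add: A_def D_def sum_subtractf right_diff_distrib mult.assoc)
    also have "norm \<dots> \<le> (\<Sum>i<n. B * (\<eta> * total_variation z (t i) (t (Suc i))))"
      using loc partition_tag_in_interval[OF t] s B B0
      by (intro sum_norm_le) (auto simp: norm_mult intro!: mult_mono)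
    also have "\<dots> = B * (\<eta> * (\<Sum>i<n. total_variation z (t i) (t (Suc i))))"
      by (simp add: sum_distrib_left)
    also have "\<dots> \<le> B * (\<eta> * L)"
      unfolding L_def using B0 \<eta> by (intro mult_left_mono sum_total_variation_le bdd t) auto
    finally have "norm (D - A) \<le> \<epsilon> / 2"
      using small by linarith
    moreover have "norm (A - I) \<le> norm (D - I) + norm (D - A)"
      using norm_triangle_ineq4[of "D - I" "D - A"] by simp
    ultimately show ?thesis
      unfolding A_def using DI by linarith
  qed
  then show "\<exists>\<delta>>0. \<forall>n t s. is_partition a b n t \<and> (\<forall>i<n. t (Suc i) - t i < \<delta> \<and> s i \<in> {t i..t (Suc i)})
      \<longrightarrow> norm ((\<Sum>i<n. q (s i) * p (s i) * (z (t (Suc i)) - z (t i))) - I) < \<epsilon>"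
    using \<delta>1(1) \<delta>2(1) by (intro exI[of _ "min \<delta>1 \<delta>2"]) auto
qed

section \<open>The path length parametrisation\<close>

lemma total_variation_image:
  assumes "rectifiable \<gamma>"
  shows "total_variation (fn \<gamma>) (lo \<gamma>) ` dom_path \<gamma> = {0..path_len \<gamma>}"
proof -
  let ?V = "total_variation (fn \<gamma>) (lo \<gamma>)"
  have le: "lo \<gamma> \<le> hi \<gamma>" and bdd: "bdd_above (variation_sums (fn \<gamma>) (lo \<gamma>) (hi \<gamma>))"
    and cont: "continuous_on {lo \<gamma>..hi \<gamma>} (fn \<gamma>)"
    using assms by (auto simp: rectifiable_def is_path_def dom_path_def)
  have "?V ` {lo \<gamma>..hi \<gamma>} = {?V (lo \<gamma>)..?V (hi \<gamma>)}"
  proof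
    show "?V ` {lo \<gamma>..hi \<gamma>} \<subseteq> {?V (lo \<gamma>)..?V (hi \<gamma>)}"
      using mono_onD[OF mono_on_total_variation[OF bdd]] le by auto
    show "{?V (lo \<gamma>)..?V (hi \<gamma>)} \<subseteq> ?V ` {lo \<gamma>..hi \<gamma>}"
    proof
      fix y assume "y \<in> {?V (lo \<gamma>)..?V (hi \<gamma>)}"
      then show "y \<in> ?V ` {lo \<gamma>..hi \<gamma>}"
        using IVT'[of ?V "lo \<gamma>" y "hi \<gamma>"] continuous_on_total_variation[OF bdd le cont] le by auto
    qed
  qed
  then show ?thesis by (simp add: total_variation_point path_len_def dom_path_def)
qed

text \<open>\<open>V\<close> maps onto \<open>[0, \<Lambda>(\<gamma>)]\<close>, and \<open>\<gamma>\<close> varies by no more than \<open>V\<close> does. So the value of \<open>\<gamma>\<close>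
  at any preimage under \<open>V\<close> is well defined and is 1-Lipschitz as a function on \<open>[0, \<Lambda>(\<gamma>)]\<close>.\<close>
lemma pl_param_exists:
  assumes rect: "rectifiable \<gamma>" and nonconst: "\<not> constant_path \<gamma>"
  shows "\<exists>\<sigma>. is_path \<sigma> \<and> lo \<sigma> = 0 \<and> hi \<sigma> = path_len \<gamma> \<and>
     (\<forall>t\<in>dom_path \<gamma>. fn \<sigma> (total_variation (fn \<gamma>) (lo \<gamma>) t) = fn \<gamma> t)"
proof -
  let ?V = "total_variation (fn \<gamma>) (lo \<gamma>)"
  have bdd: "bdd_above (variation_sums (fn \<gamma>) (lo \<gamma>) (hi \<gamma>))"
    using rect by (simp add: rectifiable_def)
  have lip: "dist (fn \<gamma> s) (fn \<gamma> t) \<le> dist (?V s) (?V t)"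
    if "s \<in> dom_path \<gamma>" "t \<in> dom_path \<gamma>" for s t
    using that norm_diff_le_variation_diff[OF bdd, of s t] norm_diff_le_variation_diff[OF bdd, of t s]
    by (cases "s \<le> t") (auto simp: dom_path_def dist_norm norm_minus_commute)
  define r where "r v = (SOME t. t \<in> dom_path \<gamma> \<and> ?V t = v)" for v
  have r: "r v \<in> dom_path \<gamma> \<and> ?V (r v) = v" if "v \<in> {0..path_len \<gamma>}" for v
  proof -
    have "\<exists>t. t \<in> dom_path \<gamma> \<and> ?V t = v"
      using that unfolding total_variation_image[OF rect, symmetric] by auto
    then show ?thesis unfolding r_def by (rule someI_ex)
  qed
  define k where "k = (\<lambda>v\<in>{0..path_len \<gamma>}. fn \<gamma> (r v))"
  have k: "k (?V t) = fn \<gamma> t" if t: "t \<in> dom_path \<gamma>" for t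
  proof -
    have v: "?V t \<in> {0..path_len \<gamma>}"
      using t total_variation_image[OF rect] by blast
    then show ?thesis
      using lip[of "r (?V t)" t] r[OF v] t by (simp add: k_def)
  qed
  have "continuous_on {0..path_len \<gamma>} k"
    unfolding continuous_on_iff
  proof (intro ballI allI impI)
    fix v and e :: real assume "v \<in> {0..path_len \<gamma>}" "e > 0"
    moreover have "dist (k w) (k v) \<le> dist w v" if "w \<in> {0..path_len \<gamma>}" "v \<in> {0..path_len \<gamma>}" for w
      using lip[of "r w" "r v"] r[OF that(1)] r[OF that(2)] that by (simp add: k_def)
    ultimately show "\<exists>d>0. \<forall>w\<in>{0..path_len \<gamma>}. dist w v < d \<longrightarrow> dist (k w) (k v) < e"
      by (intro exI[of _ e]) (meson le_less_trans)
  qed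
  \<comment> \<open>Paths have non-degenerate parameter intervals; this is where \<open>\<gamma>\<close> must not be constant.\<close>
  moreover have "0 < path_len \<gamma>"
  proof (rule ccontr)
    assume "\<not> 0 < path_len \<gamma>"
    then have "?V t = 0" if "t \<in> dom_path \<gamma>" for t
      using total_variation_image[OF rect] that by force
    then have "fn \<gamma> t = fn \<gamma> (lo \<gamma>)" if "t \<in> dom_path \<gamma>" for t
      using lip[of t "lo \<gamma>"] that by (auto simp: dom_path_def)
    then show False using nonconst by (auto simp: constant_path_def constant_on_def)
  qed
  ultimately have "is_path (Plane_Path 0 (path_len \<gamma>) k)"
    by (auto simp: is_path_def dom_path_def k_def)
  then show ?thesis
    using k by (intro exI[of _ "Plane_Path 0 (path_len \<gamma>) k"]) auto
qed

lemma pl_param_properties: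
  assumes rect: "rectifiable \<gamma>" and nonconst: "\<not> constant_path \<gamma>"
  shows "is_path (pl_param \<gamma>)" "lo (pl_param \<gamma>) = 0" "hi (pl_param \<gamma>) = path_len \<gamma>"
    "\<And>t. t \<in> dom_path \<gamma> \<Longrightarrow> fn (pl_param \<gamma>) (total_variation (fn \<gamma>) (lo \<gamma>) t) = fn \<gamma> t"
proof -
  let ?P = "\<lambda>\<sigma>. is_path \<sigma> \<and> lo \<sigma> = 0 \<and> hi \<sigma> = path_len \<gamma> \<and>
     (\<forall>t\<in>dom_path \<gamma>. fn \<sigma> (total_variation (fn \<gamma>) (lo \<gamma>) t) = fn \<gamma> t)"
  have uniq: "\<sigma> = \<tau>" if \<sigma>: "?P \<sigma>" and \<tau>: "?P \<tau>" for \<sigma> \<tau>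
  proof -
    have "fn \<sigma> v = fn \<tau> v" if "v \<in> {0..path_len \<gamma>}" for v
      using that \<sigma> \<tau> unfolding total_variation_image[OF rect, symmetric] by auto
    then have "fn \<sigma> = fn \<tau>"
      using \<sigma> \<tau> by (intro extensionalityI[of _ "{0..path_len \<gamma>}"]) (auto simp: is_path_def dom_path_def)
    then show ?thesis
      using \<sigma> \<tau> by (intro plane_path.expand) simp
  qed
  have "\<exists>!\<sigma>. ?P \<sigma>"
    using pl_param_exists[OF assms] uniq by (intro ex_ex1I) blast+
  then have "?P (pl_param \<gamma>)"
    unfolding pl_param_def by (rule theI')
  then show "is_path (pl_param \<gamma>)" "lo (pl_param \<gamma>) = 0" "hi (pl_param \<gamma>) = path_len \<gamma>"
    "\<And>t. t \<in> dom_path \<gamma> \<Longrightarrow> fn (pl_param \<gamma>) (total_variation (fn \<gamma>) (lo \<gamma>) t) = fn \<gamma> t"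
    by blast+
qed

lemma path_integral_from_pl_param:
  assumes rect: "rectifiable \<gamma>" and nonconst: "\<not> constant_path \<gamma>"
    and int: "has_path_integral g I (pl_param \<gamma>)"
  shows "has_path_integral g I \<gamma>"
proof -
  let ?V = "total_variation (fn \<gamma>) (lo \<gamma>)"
  note pl = pl_param_properties[OF rect nonconst]
  have le: "lo \<gamma> \<le> hi \<gamma>" and bdd: "bdd_above (variation_sums (fn \<gamma>) (lo \<gamma>) (hi \<gamma>))"
    and cont: "continuous_on {lo \<gamma>..hi \<gamma>} (fn \<gamma>)"
    using rect by (auto simp: rectifiable_def is_path_def dom_path_def)
  have "has_RS_integral (\<lambda>v. g (fn (pl_param \<gamma>) v)) (fn (pl_param \<gamma>)) I (?V (lo \<gamma>)) (?V (hi \<gamma>))"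
    using int pl by (simp add: has_path_integral_def total_variation_point path_len_def)
  then have "has_RS_integral (\<lambda>t. g (fn (pl_param \<gamma>) (?V t))) (\<lambda>t. fn (pl_param \<gamma>) (?V t)) I (lo \<gamma>) (hi \<gamma>)"
    by (rule has_RS_integral_reparametrize)
       (use continuous_on_total_variation[OF bdd le cont] mono_on_total_variation[OF bdd] in auto)
  then show ?thesis
    unfolding has_path_integral_def
    by (rule has_RS_integral_cong) (use pl in \<open>auto simp: dom_path_def\<close>)
qed

section \<open>Uniqueness of derivatives\<close>

lemma effective_path:
  assumes "effective X F" "\<gamma> \<in> F"
  shows "is_path \<gamma>" "admissible \<gamma>" "lo \<gamma> < hi \<gamma>" "fn \<gamma> ` {lo \<gamma>..hi \<gamma>} \<subseteq> X"
    "continuous_on {lo \<gamma>..hi \<gamma>} (fn \<gamma>)"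
    "bdd_above (variation_sums (fn \<gamma>) (lo \<gamma>) (hi \<gamma>))"
proof -
  have "is_path_in \<gamma> X" and adm: "admissible \<gamma>"
    using assms by (simp_all add: effective_def)
  then show "is_path \<gamma>" "admissible \<gamma>" "lo \<gamma> < hi \<gamma>" "fn \<gamma> ` {lo \<gamma>..hi \<gamma>} \<subseteq> X"
    "continuous_on {lo \<gamma>..hi \<gamma>} (fn \<gamma>)"
    by (simp_all add: is_path_in_def is_path_def path_trace_def dom_path_def)
  show "bdd_above (variation_sums (fn \<gamma>) (lo \<gamma>) (hi \<gamma>))"
    using adm by (simp add: admissible_def rectifiable_def)
qed

lemma F_derivative_on_subinterval:
  assumes eff: "effective X F" and der: "is_F_derivative X F f g" and "\<gamma> \<in> F"
    and "lo \<gamma> \<le> c" "c < d" "d \<le> hi \<gamma>"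
  shows "has_RS_integral (\<lambda>t. g (fn \<gamma> t)) (fn \<gamma>) (f (fn \<gamma> d) - f (fn \<gamma> c)) c d"
proof -
  let ?\<sigma> = "Plane_Path c d (restrict (fn \<gamma>) {c..d})"
  have "?\<sigma> \<in> F"
    using eff \<open>\<gamma> \<in> F\<close> assms(4-6) unfolding effective_def subpaths_def by blast
  then have "has_path_integral g (f (final_pt ?\<sigma>) - f (initial_pt ?\<sigma>)) ?\<sigma>"
    using der by (auto simp: is_F_derivative_def)
  then have "has_RS_integral (\<lambda>t. g (restrict (fn \<gamma>) {c..d} t)) (restrict (fn \<gamma>) {c..d})
      (f (fn \<gamma> d) - f (fn \<gamma> c)) c d"
    using \<open>c < d\<close> by (simp add: has_path_integral_def final_pt_def initial_pt_def)
  then show ?thesis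
    by (rule has_RS_integral_cong) auto
qed

text \<open>If \<open>g1\<close> and \<open>g2\<close> differ at \<open>x = \<gamma> t0\<close>, then near \<open>t0\<close> both stay within a
  quarter of their distance from \<open>g1 x\<close> and \<open>g2 x\<close>. As they have the same integrals, each
  increment of \<open>\<gamma>\<close> near \<open>t0\<close> is at most half the variation over the same interval. Summing over
  partitions shows that the variation is at most half of itself, so that \<open>\<gamma>\<close> is constant
  near \<open>t0\<close>, which admissibility excludes.\<close>
lemma F_derivatives_agree_on_path:
  assumes eff: "effective X F" and g1: "is_F_derivative X F f g1" and g2: "is_F_derivative X F f g2"
    and \<gamma>: "\<gamma> \<in> F" and x: "x \<in> path_trace \<gamma>"
  shows "g1 x = g2 x"
proof (rule ccontr)
  assume ne: "g1 x \<noteq> g2 x"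
  obtain t0 where t0: "t0 \<in> {lo \<gamma>..hi \<gamma>}" "x = fn \<gamma> t0"
    using x by (auto simp: path_trace_def dom_path_def)
  note path = effective_path[OF eff \<gamma>]
  note adm = path(2) and lt = path(3) and \<gamma>X = path(4) and cont = path(5) and bdd = path(6)
  define e where "e = norm (g1 x - g2 x) / 4"
  have e: "e > 0" using ne by (simp add: e_def)
  have near: "\<exists>\<delta>>0. \<forall>t\<in>{lo \<gamma>..hi \<gamma>}. dist t t0 < \<delta> \<longrightarrow> norm (g (fn \<gamma> t) - g x) \<le> e"
    if "g \<in> CX X" for g
  proof -
    have "continuous_on {lo \<gamma>..hi \<gamma>} (\<lambda>t. g (fn \<gamma> t))"
      using that by (intro continuous_on_compose2[OF _ cont \<gamma>X]) (simp add: CX_def)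
    then obtain \<delta> where "\<delta> > 0"
      "\<forall>t\<in>{lo \<gamma>..hi \<gamma>}. dist t t0 < \<delta> \<longrightarrow> dist (g (fn \<gamma> t)) (g (fn \<gamma> t0)) < e"
      using t0(1) e unfolding continuous_on_iff by meson
    then show ?thesis
      using t0(2) by (auto simp: dist_norm less_imp_le)
  qed
  obtain \<delta>1 where \<delta>1: "\<delta>1 > 0" "\<forall>t\<in>{lo \<gamma>..hi \<gamma>}. dist t t0 < \<delta>1 \<longrightarrow> norm (g1 (fn \<gamma> t) - g1 x) \<le> e"
    using near g1 unfolding is_F_derivative_def by blast
  obtain \<delta>2 where \<delta>2: "\<delta>2 > 0" "\<forall>t\<in>{lo \<gamma>..hi \<gamma>}. dist t t0 < \<delta>2 \<longrightarrow> norm (g2 (fn \<gamma> t) - g2 x) \<le> e"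
    using near g2 unfolding is_F_derivative_def by blast
  define \<delta> where "\<delta> = min \<delta>1 \<delta>2 / 2"
  define c d where "c = max (lo \<gamma>) (t0 - \<delta>)" and "d = min (hi \<gamma>) (t0 + \<delta>)"
  have cd: "lo \<gamma> \<le> c" "c < d" "d \<le> hi \<gamma>"
    using t0(1) lt \<delta>1(1) \<delta>2(1) by (auto simp: c_def d_def \<delta>_def)
  have close: "norm (g1 (fn \<gamma> t) - g1 x) \<le> e" "norm (g2 (fn \<gamma> t) - g2 x) \<le> e" if "t \<in> {c..d}" for t
  proof -
    have "t \<in> {lo \<gamma>..hi \<gamma>}" "dist t t0 < \<delta>1" "dist t t0 < \<delta>2"
      using that \<delta>1(1) \<delta>2(1) unfolding c_def d_def \<delta>_def dist_real_def by auto
    then show "norm (g1 (fn \<gamma> t) - g1 x) \<le> e" "norm (g2 (fn \<gamma> t) - g2 x) \<le> e"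
      using \<delta>1(2) \<delta>2(2) by auto
  qed
  note bdd_sub = bdd_above_variation_sums_subinterval[OF bdd]
  have half: "norm (fn \<gamma> t - fn \<gamma> s) \<le> total_variation (fn \<gamma>) s t / 2"
    if st: "c \<le> s" "s \<le> t" "t \<le> d" for s t
  proof (cases "s < t")
    case True
    let ?V = "total_variation (fn \<gamma>) s t" and ?\<Delta> = "fn \<gamma> t - fn \<gamma> s"
    let ?I = "f (fn \<gamma> t) - f (fn \<gamma> s)"
    have sub: "lo \<gamma> \<le> s" "t \<le> hi \<gamma>" using st cd by auto
    have "norm (?I - g1 x * ?\<Delta>) \<le> e * ?V"
      using st sub close(1) True
      by (intro RS_integral_minus_const_bound[OF F_derivative_on_subinterval[OF eff g1 \<gamma>]] bdd_sub) auto
    moreover have "norm (?I - g2 x * ?\<Delta>) \<le> e * ?V"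
      using st sub close(2) True
      by (intro RS_integral_minus_const_bound[OF F_derivative_on_subinterval[OF eff g2 \<gamma>]] bdd_sub) auto
    ultimately have "norm (g1 x * ?\<Delta> - g2 x * ?\<Delta>) \<le> 2 * (e * ?V)"
      using norm_triangle_ineq4[of "?I - g2 x * ?\<Delta>" "?I - g1 x * ?\<Delta>"] by simp
    also have "g1 x * ?\<Delta> - g2 x * ?\<Delta> = (g1 x - g2 x) * ?\<Delta>"
      by (simp add: left_diff_distrib)
    finally have "4 * e * norm ?\<Delta> \<le> 4 * e * (?V / 2)"
      by (simp add: norm_mult e_def mult.commute)
    then show ?thesis using e by simp
  next
    case False
    then show ?thesis using st by (simp add: total_variation_point)
  qed
  have bdd_cd: "bdd_above (variation_sums (fn \<gamma>) c d)"
    using cd by (intro bdd_sub) auto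
  have "total_variation (fn \<gamma>) c d \<le> total_variation (fn \<gamma>) c d / 2"
  proof (rule total_variation_least)
    show "c \<le> d" using cd by simp
    fix n t assume t: "is_partition c d n t"
    have "(\<Sum>i<n. norm (fn \<gamma> (t (Suc i)) - fn \<gamma> (t i)))
        \<le> (\<Sum>i<n. total_variation (fn \<gamma>) (t i) (t (Suc i)) / 2)"
    proof (intro sum_mono half)
      fix i assume "i \<in> {..<n}"
      then show "c \<le> t i" "t i \<le> t (Suc i)" "t (Suc i) \<le> d"
        using partition_in_interval[OF t, of i] partition_in_interval[OF t, of "Suc i"] t
        by (auto simp: is_partition_def)
    qed
    also have "\<dots> \<le> total_variation (fn \<gamma>) c d / 2"
      using sum_total_variation_le[OF bdd_cd t] by (simp add: sum_divide_distrib[symmetric])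
    finally show "(\<Sum>i<n. norm (fn \<gamma> (t (Suc i)) - fn \<gamma> (t i))) \<le> total_variation (fn \<gamma>) c d / 2" .
  qed
  then have V0: "total_variation (fn \<gamma>) c d \<le> 0" by simp
  have "fn \<gamma> t = fn \<gamma> c" if "t \<in> {c..d}" for t
  proof -
    have "norm (fn \<gamma> t - fn \<gamma> c) \<le> total_variation (fn \<gamma>) c t - total_variation (fn \<gamma>) c c"
      using that by (intro norm_diff_le_variation_diff[OF bdd_cd]) auto
    moreover have "total_variation (fn \<gamma>) c t \<le> total_variation (fn \<gamma>) c d"
      using that by (intro mono_onD[OF mono_on_total_variation[OF bdd_cd]]) auto
    ultimately have "norm (fn \<gamma> t - fn \<gamma> c) \<le> 0"
      using V0 unfolding total_variation_point by linarith
    then show ?thesis by simp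
  qed
  then have "\<forall>t\<in>{c..d}. restrict (fn \<gamma>) {c..d} t = fn \<gamma> c"
    by (metis restrict_apply')
  then have "constant_path (Plane_Path c d (restrict (fn \<gamma>) {c..d}))"
    unfolding constant_path_def constant_on_def dom_path_def plane_path.sel by blast
  moreover have "Plane_Path c d (restrict (fn \<gamma>) {c..d}) \<in> subpaths \<gamma>"
    using cd by (auto simp: subpaths_def)
  ultimately show False
    using adm by (auto simp: admissible_def)
qed

text \<open>The traces of the paths of \<open>F\<close> are dense in \<open>X\<close>, and agreement of continuous
  functions passes to the closure.\<close>
lemma F_derivative_unique:
  assumes "closed X" and eff: "effective X F"
    and g1: "is_F_derivative X F f g1" and g2: "is_F_derivative X F f g2"
  shows "g1 = g2"
proof -
  have C: "g1 \<in> CX X" "g2 \<in> CX X"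
    using g1 g2 by (auto simp: is_F_derivative_def)
  have "continuous_on X (\<lambda>x. g1 x - g2 x)"
    using C by (intro continuous_on_diff) (auto simp: CX_def)
  then have "closed {x \<in> X. g1 x - g2 x = 0}"
    using \<open>closed X\<close> by (rule continuous_closed_preimage_constant)
  then have "closed {x \<in> X. g1 x = g2 x}"
    by simp
  moreover have "(\<Union>\<gamma>\<in>F. path_trace \<gamma>) \<subseteq> {x \<in> X. g1 x = g2 x}"
    using F_derivatives_agree_on_path[OF eff g1 g2] eff
    by (auto simp: effective_def is_path_in_def)
  ultimately have "X \<subseteq> {x \<in> X. g1 x = g2 x}"
    using eff closure_minimal unfolding effective_def by (metis (no_types, lifting) order_trans)
  then show ?thesis
    using C by (intro extensionalityI[of _ X]) (auto simp: CX_def)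
qed

lemma F_deriv_eq:
  assumes "closed X" "effective X F" "is_F_derivative X F f g"
  shows "F_deriv X F f = g"
  unfolding F_deriv_def
  using assms F_derivative_unique[OF assms(1,2)] by (intro the_equality) blast+

lemma F_deriv_is_F_derivative:
  assumes "closed X" "effective X F" "f \<in> D1 X F"
  shows "is_F_derivative X F f (F_deriv X F f)"
  using assms F_deriv_eq by (auto simp: D1_def F_differentiable_def)

section \<open>The chain rule\<close>

lemma path_integral_of_m_path:
  assumes "\<sigma> \<in> m_paths Y G" "f \<in> D1 Y G"
  shows "has_path_integral (F_deriv Y G f) (f (final_pt \<sigma>) - f (initial_pt \<sigma>)) \<sigma>"
proof -
  have path: "is_path \<sigma>"
    using assms by (auto simp: m_paths_def is_path_in_def)
  then have "restrict (fn \<sigma>) {lo \<sigma>..hi \<sigma>} = fn \<sigma>"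
    by (auto simp: is_path_def dom_path_def extensional_restrict)
  then have "\<sigma> \<in> subpaths \<sigma>"
    using path unfolding subpaths_def is_path_def
    by (intro CollectI exI[of _ "lo \<sigma>"] exI[of _ "hi \<sigma>"]) (auto intro: plane_path.expand)
  then show ?thesis
    using assms by (auto simp: m_paths_def is_path_derivative_def)
qed

text \<open>The increments of \<open>\<phi> \<circ> \<gamma>\<close> are integrals of \<open>p\<close> along \<open>\<gamma>\<close>, so they are at most the bound of
  \<open>p\<close> on \<open>X\<close> times the variation of \<open>\<gamma>\<close>.\<close>
lemma rectifiable_comp_path:
  assumes X: "compact X" and eff: "effective X F" and der: "is_F_derivative X F \<phi> p" and \<gamma>: "\<gamma> \<in> F"
  shows "rectifiable (comp_path \<phi> \<gamma>)"
proof -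
  note path = effective_path[OF eff \<gamma>]
  note le = path(3) and \<gamma>X = path(4) and cont = path(5) and bdd = path(6)
  let ?h = "compose {lo \<gamma>..hi \<gamma>} \<phi> (fn \<gamma>)"
  have C: "continuous_on X \<phi>" "continuous_on X p"
    using der by (auto simp: is_F_derivative_def CX_def)
  have "continuous_on {lo \<gamma>..hi \<gamma>} (\<lambda>t. \<phi> (fn \<gamma> t))"
    by (rule continuous_on_compose2[OF C(1) cont \<gamma>X])
  then have "continuous_on {lo \<gamma>..hi \<gamma>} ?h"
    by (rule continuous_on_eq) (simp add: compose_eq)
  then have "is_path (comp_path \<phi> \<gamma>)"
    using le by (simp add: is_path_def comp_path_def dom_path_def)
  moreover obtain M where M: "\<And>x. x \<in> X \<Longrightarrow> norm (p x) \<le> M"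
    using compact_imp_bounded[OF compact_continuous_image[OF C(2) X]] by (auto simp: bounded_iff)
  have pM: "norm (p (fn \<gamma> t)) \<le> M" if "t \<in> {lo \<gamma>..hi \<gamma>}" for t
    using M \<gamma>X that by blast
  have "has_RS_integral (\<lambda>t. p (fn \<gamma> t)) (fn \<gamma>) (?h d - ?h c) c d"
    if "lo \<gamma> \<le> c" "c < d" "d \<le> hi \<gamma>" for c d
    using F_derivative_on_subinterval[OF eff der \<gamma> that] that by (simp add: compose_eq)
  then have "bdd_above (variation_sums ?h (lo \<gamma>) (hi \<gamma>))"
    using le pM
    by (intro bdd_above_variation_sums_indefinite_integral[OF _ bdd, of "\<lambda>t. p (fn \<gamma> t)" M]) auto
  ultimately show ?thesis
    by (simp add: rectifiable_def comp_path_def dom_path_def)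
qed

lemma chain_rule_is_F_derivative:
  assumes X: "compact X" and Y: "compact Y" and effX: "effective X F" and effY: "effective Y G"
    and comp: "compatible X F Y G \<phi>" and f: "f \<in> D1 Y G"
  shows "is_F_derivative X F (compose X f \<phi>) (\<lambda>x\<in>X. F_deriv Y G f (\<phi> x) * F_deriv X F \<phi> x)"
proof -
  define g p where "g = F_deriv Y G f" and "p = F_deriv X F \<phi>"
  have \<phi>Y: "\<phi> ` X \<subseteq> Y" and \<phi>: "\<phi> \<in> D1 X F"
    using comp by (auto simp: compatible_def)
  have fg: "is_F_derivative Y G f g"
    unfolding g_def using Y effY f by (intro F_deriv_is_F_derivative compact_imp_closed)
  have \<phi>p: "is_F_derivative X F \<phi> p"
    unfolding p_def using X effX \<phi> by (intro F_deriv_is_F_derivative compact_imp_closed)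
  have C: "continuous_on Y f" "continuous_on Y g" "continuous_on X \<phi>" "continuous_on X p"
    using fg \<phi>p by (auto simp: is_F_derivative_def CX_def)
  have "continuous_on X (\<lambda>x. f (\<phi> x))" "continuous_on X (\<lambda>x. g (\<phi> x))"
    using continuous_on_compose2[OF C(1) C(3) \<phi>Y] continuous_on_compose2[OF C(2) C(3) \<phi>Y] by auto
  then have "continuous_on X (compose X f \<phi>)" and cgp: "continuous_on X (\<lambda>x. g (\<phi> x) * p x)"
    using C by (auto simp: compose_def intro!: continuous_intros)
  then have CX: "compose X f \<phi> \<in> CX X" "(\<lambda>x\<in>X. g (\<phi> x) * p x) \<in> CX X"
    by (simp_all add: CX_def)
  have "has_path_integral (\<lambda>x\<in>X. g (\<phi> x) * p x)
      (compose X f \<phi> (final_pt \<gamma>) - compose X f \<phi> (initial_pt \<gamma>)) \<gamma>" if \<gamma>: "\<gamma> \<in> F" for \<gamma>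
  proof -
    note path = effective_path[OF effX \<gamma>]
    note le = less_imp_le[OF path(3)] and \<gamma>X = path(4) and cont = path(5) and bdd = path(6)
    have inX: "fn \<gamma> t \<in> X" if "t \<in> {lo \<gamma>..hi \<gamma>}" for t
      using \<gamma>X that by blast
    let ?h = "\<lambda>t. \<phi> (fn \<gamma> t)" and ?\<eta> = "comp_path \<phi> \<gamma>"
    have \<eta>: "lo ?\<eta> = lo \<gamma>" "hi ?\<eta> = hi \<gamma>" "\<And>t. t \<in> {lo \<gamma>..hi \<gamma>} \<Longrightarrow> fn ?\<eta> t = ?h t"
      by (simp_all add: comp_path_def dom_path_def compose_eq)
    have "has_path_integral g (f (?h (hi \<gamma>)) - f (?h (lo \<gamma>))) ?\<eta>"
    proof (cases "constant_path ?\<eta>")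
      case True
      then obtain c where c: "\<And>t. t \<in> {lo \<gamma>..hi \<gamma>} \<Longrightarrow> fn ?\<eta> t = c"
        using \<eta> by (auto simp: constant_path_def constant_on_def dom_path_def)
      then have "has_RS_integral (\<lambda>t. g (fn ?\<eta> t)) (fn ?\<eta>) 0 (lo \<gamma>) (hi \<gamma>)"
        by (rule has_RS_integral_constant_integrator)
      moreover have "?h (hi \<gamma>) = ?h (lo \<gamma>)"
        using c[of "lo \<gamma>"] c[of "hi \<gamma>"] \<eta>(3)[of "lo \<gamma>"] \<eta>(3)[of "hi \<gamma>"] le by simp
      ultimately show ?thesis
        by (simp add: has_path_integral_def \<eta>(1,2))
    next
      case False
      have rect: "rectifiable ?\<eta>"
        by (rule rectifiable_comp_path[OF X effX \<phi>p \<gamma>])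
      note pl = pl_param_properties[OF rect False]
      have ends: "initial_pt (pl_param ?\<eta>) = ?h (lo \<gamma>)" "final_pt (pl_param ?\<eta>) = ?h (hi \<gamma>)"
        using pl(2,3) pl(4)[of "lo \<gamma>"] pl(4)[of "hi \<gamma>"] le \<eta>
        by (simp_all add: initial_pt_def final_pt_def dom_path_def path_len_def total_variation_point)
      have "pl_param ?\<eta> \<in> m_paths Y G"
        using comp \<gamma> False by (auto simp: compatible_def)
      then have "has_path_integral g (f (?h (hi \<gamma>)) - f (?h (lo \<gamma>))) (pl_param ?\<eta>)"
        using path_integral_of_m_path[OF _ f] ends by (metis g_def)
      then show ?thesis
        by (rule path_integral_from_pl_param[OF rect False])
    qed
    then have "has_RS_integral (\<lambda>t. g (fn ?\<eta> t)) (fn ?\<eta>)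
        (f (?h (hi \<gamma>)) - f (?h (lo \<gamma>))) (lo \<gamma>) (hi \<gamma>)"
      by (simp add: has_path_integral_def \<eta>(1,2))
    \<comment> \<open>\<open>\<integral> (g \<circ> h) dh\<close> is now known; replacing \<open>dh\<close> by \<open>p d\<gamma>\<close> gives the integral of the claim.\<close>
    then have gh: "has_RS_integral (\<lambda>t. g (?h t)) ?h
        (f (?h (hi \<gamma>)) - f (?h (lo \<gamma>))) (lo \<gamma>) (hi \<gamma>)"
      by (rule has_RS_integral_cong) (simp_all add: \<eta>(3))
    obtain B where B: "\<And>y. y \<in> Y \<Longrightarrow> norm (g y) \<le> B"
      using compact_imp_bounded[OF compact_continuous_image[OF C(2) Y]] by (auto simp: bounded_iff)
    have "continuous_on {lo \<gamma>..hi \<gamma>} (\<lambda>t. p (fn \<gamma> t))"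
      by (rule continuous_on_compose2[OF C(4) cont \<gamma>X])
    then have "has_RS_integral (\<lambda>t. g (?h t) * p (fn \<gamma> t)) (fn \<gamma>)
        (f (?h (hi \<gamma>)) - f (?h (lo \<gamma>))) (lo \<gamma>) (hi \<gamma>)"
      using inX \<phi>Y B F_derivative_on_subinterval[OF effX \<phi>p \<gamma>]
      by (intro has_RS_integral_mult_density[OF le bdd _ _ _ gh, of _ B]) auto
    then have "has_RS_integral (\<lambda>t. (\<lambda>x\<in>X. g (\<phi> x) * p x) (fn \<gamma> t)) (fn \<gamma>)
        (f (?h (hi \<gamma>)) - f (?h (lo \<gamma>))) (lo \<gamma>) (hi \<gamma>)"
      by (rule has_RS_integral_cong) (simp_all add: inX)
    then show ?thesis
      using inX[of "lo \<gamma>"] inX[of "hi \<gamma>"] le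
      by (simp add: has_path_integral_def initial_pt_def final_pt_def compose_eq)
  qed
  then show ?thesis
    using CX unfolding is_F_derivative_def g_def p_def by blast
qed

theorem theorem4p2:
  fixes X Y :: "complex set" and F G :: "plane_path set"
    and \<phi> :: "complex \<Rightarrow> complex"
  assumes "semi_rectifiable X" and "semi_rectifiable Y"
    and "effective X F" and "effective Y G"
    and "\<phi> \<in> D1 X F" and "\<phi> ` X \<subseteq> Y"
    and "compatible X F Y G \<phi>"
  shows "\<forall>f\<in>D1 Y G.
    F_differentiable X F (compose X f \<phi>) \<and>
    F_deriv X F (compose X f \<phi>) = (\<lambda>x\<in>X. F_deriv Y G f (\<phi> x) * F_deriv X F \<phi> x)"
proof
  fix f assume "f \<in> D1 Y G"
  have "compact X" "compact Y"
    using assms(1,2) by (simp_all add: semi_rectifiable_def compact_plane_set_def)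
  then have "is_F_derivative X F (compose X f \<phi>) (\<lambda>x\<in>X. F_deriv Y G f (\<phi> x) * F_deriv X F \<phi> x)"
    using assms \<open>f \<in> D1 Y G\<close> by (intro chain_rule_is_F_derivative)
  then show "F_differentiable X F (compose X f \<phi>) \<and>
    F_deriv X F (compose X f \<phi>) = (\<lambda>x\<in>X. F_deriv Y G f (\<phi> x) * F_deriv X F \<phi> x)"
    using F_deriv_eq[OF compact_imp_closed[OF \<open>compact X\<close>] assms(3)]
    by (auto simp: F_differentiable_def)
qed

end
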